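(* Let $n \geq 2$ be an integer and let $g : \{1,\dots,n\} \to \mathbb{R}$ be a strictly monotonically increasing function. For each integer $l$ with $1 \leq l \leq n+1$, let $$D_l = \sum_{d=1}^{l-1} g(d) + \sum_{d=1}^{n+1-l} g(d).$$ Then $D_l$ is quasi-convex on $\{1,\dots,n+1\}$, i.e. for all integers $l_1, l_2, l_3$ with $1 \leq l_1 \leq l_2 \leq l_3 \leq n+1$, $$D_{l_2} \leq \max(D_{l_1}, D_{l_3}).$$
   Context: A head and its $n$ dependents occupy the positions $1,\dots,n+1$ of a sequence, with the head at position $l$. The cost of a dependency of length $d$ (the absolute difference of the positions of the head and the dependent) is $g(d)$, and $D_l$ is the total cost of the $n$ dependencies, $D_l = \sum_{i=1}^{l-1} g(l-i) + \sum_{i=l+1}^{n+1} g(i-l)$, which is the expression used in the claim. Empty sums are $0$. *)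

theory Defs
  imports Complex_Main
begin

(* Total cost of the dependencies of a head at position l among the positions 1..n+1,
   indexed by dependency length: the l - 1 dependents before the head are at distances
   1..l-1, the n + 1 - l dependents after it at distances 1..n+1-l.  Meant for
   1 \<le> l \<le> n + 1, where neither subtraction truncates and g is evaluated only on {1..n}. *)
definition total_cost :: "nat \<Rightarrow> (nat \<Rightarrow> real) \<Rightarrow> nat \<Rightarrow> real" where
  "total_cost n g l = (\<Sum>d = 1..l - 1. g d) + (\<Sum>d = 1..n + 1 - l. g d)"

definition quasi_convex_on :: "nat set \<Rightarrow> (nat \<Rightarrow> real) \<Rightarrow> bool" where
  "quasi_convex_on S f \<longleftrightarrow>
     (\<forall>l1\<in>S. \<forall>l2\<in>S. \<forall>l3\<in>S. l1 \<le> l2 \<and> l2 \<le> l3 \<longrightarrow> f l2 \<le> max (f l1) (f l3))"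

end

(* The increment D(l+1) - D(l) equals g(l) - g(n+1-l), whose sign for increasing g is that of
   2 l - (n+1): the cost decreases up to the middle of the sequence and increases after it. *)
theory Submission
  imports Defs
begin

text \<open>Moving the head from \<open>l\<close> to \<open>l + 1\<close> trades a dependency of
  length \<open>n + 1 - l\<close> for one of length \<open>l\<close>. For increasing
  \<open>g\<close> this cannot raise the cost while \<open>2 * l \<le> n + 1\<close>, nor lower it
  once \<open>n + 1 \<le> 2 * l\<close>. So \<open>l2\<close> is compared with \<open>l1\<close> in
  the left half and with \<open>l3\<close> in the right half.\<close>

lemma total_cost_Suc:
  assumes "1 \<le> l" "l \<le> n"
  shows "total_cost n g (Suc l) = total_cost n g l + g l - g (n + 1 - l)"
proof -
  have "(\<Sum>d = 1..l. g d) = (\<Sum>d = 1..l - 1. g d) + g l"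
    using assms by (cases l) simp_all
  \<comment> \<open>This form splits the longest dependency off the right-hand sum.\<close>
  moreover have "n + 1 - l = Suc (n - l)"
    using assms by simp
  ultimately show ?thesis
    by (simp add: total_cost_def)
qed

text \<open>Each step from \<open>m\<close> to \<open>Suc m \<le> l\<close> has
  \<open>m \<le> n + 1 - m\<close>, so its increment is at most 0.\<close>

lemma total_cost_antimono_left:
  assumes "mono_on {1..n} g" "1 \<le> k" "k \<le> l" "2 * l \<le> n + 1"
  shows "total_cost n g l \<le> total_cost n g k"
  using assms(3,4)
proof (induction l rule: dec_induct)
  case (step m)
  have "g m \<le> g (n + 1 - m)"
    using step.hyps step.prems assms(2) by (intro mono_onD[OF assms(1)]) auto
  then show ?case
    using step total_cost_Suc[of m n g] assms(2) by simp
qed simp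

lemma total_cost_mono_right:
  assumes "mono_on {1..n} g" "n + 1 \<le> 2 * k" "k \<le> l" "l \<le> n + 1"
  shows "total_cost n g k \<le> total_cost n g l"
  using assms(3,4)
proof (induction l rule: dec_induct)
  case (step m)
  \<comment> \<open>Here \<open>n + 1 \<le> 2 * k \<le> 2 * m\<close>, which also forces
    \<open>1 \<le> m\<close>.\<close>
  have "g (n + 1 - m) \<le> g m"
    using step.hyps step.prems assms(2) by (intro mono_onD[OF assms(1)]) auto
  then show ?case
    using step total_cost_Suc[of m n g] assms(2) by simp
qed simp

theorem corollary2p2:
  fixes n :: nat and g :: "nat \<Rightarrow> real"
  assumes "n \<ge> 2"
    and "strict_mono_on {1..n} g"
  shows "quasi_convex_on {1..n + 1} (total_cost n g)"
  unfolding quasi_convex_on_def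
proof (intro ballI impI)
  fix l1 l2 l3
  assume l: "l1 \<in> {1..n + 1}" "l2 \<in> {1..n + 1}" "l3 \<in> {1..n + 1}" "l1 \<le> l2 \<and> l2 \<le> l3"
  have mono: "mono_on {1..n} g"
    using assms(2) by (rule strict_mono_on_imp_mono_on)
  show "total_cost n g l2 \<le> max (total_cost n g l1) (total_cost n g l3)"
  proof (cases "2 * l2 \<le> n + 1")
    case True
    then have "total_cost n g l2 \<le> total_cost n g l1"
      using l by (intro total_cost_antimono_left[OF mono]) auto
    then show ?thesis by simp
  next
    case False
    then have "total_cost n g l2 \<le> total_cost n g l3"
      using l by (intro total_cost_mono_right[OF mono]) auto
    then show ?thesis by simp
  qed
qed

end
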